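(* Let $n\ge 1$, let $\mu$ be a partition of length at most $n$ and let $r\ge 1$ be an integer. Then $$\overline{p}_r\,\mathrm{sp}_{\mu}=\sum_{\eta/\mu\in \mathrm{BS}(r)}(-1)^{\mathrm{ht}(\eta/\mu)}\,\mathrm{sp}_{\eta}+\sum_{\mu/\xi\in \mathrm{BS}(r)}(-1)^{\mathrm{ht}(\mu/\xi)}\,\mathrm{sp}_{\xi}+\sum_{q=m(\mu)+1}^{n}(-1)^{p(q)-q+1}\,\mathrm{sp}_{\mu^{(q)}},$$ where the first sum is over partitions $\eta\supseteq\mu$ such that $\eta/\mu$ is a border strip with $r$ boxes, and the second is over partitions $\xi\subseteq\mu$ such that $\mu/\xi$ is a border strip with $r$ boxes.
   Context: Let $X=(x_1,\dots,x_n)$ be commuting indeterminates and $\bar x_i=x_i^{-1}$. Put $\overline{p}_r=\sum_{i=1}^n(x_i^r+\bar x_i^{\,r})$. Partitions are identified with their Young diagrams. A border strip is a (nonempty) skew diagram that is connected (any two boxes are joined by a sequence of boxes, consecutive ones sharing a side) and contains no $2\times2$ block of boxes. Its height $\mathrm{ht}$ is one less than its number of nonempty rows. $\mathrm{BS}(r)$ denotes the border strips with exactly $r$ boxes. For a partition $\lambda=(\lambda_1,\dots,\lambda_n)$ of length at most $n$ (padded with zeros), the symplectic Schur polynomial is $$\mathrm{sp}_\lambda=\mathrm{sp}_{\lambda}(X)=\frac{\det_{1\le i,j\le n}\bigl(x_i^{\lambda_j+n-j+1}-\bar x_i^{\lambda_j+n-j+1}\bigr)}{\det_{1\le i,j\le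 n}\bigl(x_i^{n-j+1}-\bar x_i^{n-j+1}\bigr)};$$ for partitions of length greater than $n$, $\mathrm{sp}_\lambda=0$. Let $\delta=(n,n-1,\dots,1)$. Define $m(\mu)=0$ if $\mu_i+\delta_i<r$ for all $i\in\{1,\dots,n\}$, and $m(\mu)=\max\{i\mid \mu_i+\delta_i\ge r\}$ otherwise. For $q$ with $\mu_q+\delta_q-r<0$ (i.e. $q>m(\mu)$), let $\Delta_q$ be the rearrangement in descending order of $$(\mu_1+\delta_1,\dots,\mu_{q-1}+\delta_{q-1},\,r-(\mu_q+\delta_q),\,\mu_{q+1}+\delta_{q+1},\dots,\mu_n+\delta_n),$$ and set $\mu^{(q)}=\Delta_q-\delta$. If $r-(\mu_q+\delta_q)=\mu_j+\delta_j$ for some $j\ne q$, then $\mu^{(q)}$ is not a partition and one sets $\mathrm{sp}_{\mu^{(q)}}=0$ (the corresponding term of the sum is $0$). Otherwise $\mu^{(q)}$ is a partition and $p(q)$ denotes the index (position) of the entry $r-(\mu_q+\delta_q)$ in $\Delta_q$. *)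

theory Defs
  imports
    "HOL-Library.Poly_Mapping"
    "HOL-Computational_Algebra.Fraction_Field"
    "Jordan_Normal_Form.Determinant"
begin

text \<open>
  A monomial is a finitely supported exponent function, so \<open>(nat \<Rightarrow>\<^sub>0 nat) \<Rightarrow>\<^sub>0 int\<close> is the
  polynomial ring over the integers in indeterminates indexed by \<open>nat\<close>, and \<open>ratfun\<close> is its
  field of fractions.  For a given \<open>n\<close> only the indeterminates with indices \<open>1, \<dots>, n\<close> are used.
\<close>

type_synonym ratfun = "((nat \<Rightarrow>\<^sub>0 nat) \<Rightarrow>\<^sub>0 int) fract"

definition indet :: "nat \<Rightarrow> ratfun" where
  "indet i = Fract (Poly_Mapping.single (Poly_Mapping.single i 1) 1) 1"

definition pbar :: "nat \<Rightarrow> nat \<Rightarrow> ratfun" where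
  "pbar n r = (\<Sum>i=1..n. indet i ^ r + inverse (indet i) ^ r)"

text \<open>
  Parts are indexed from 1.  The value at the unused index 0 is fixed to 0, so that equal
  partitions are equal functions; this matters for the sums over partitions.
\<close>

definition is_partition :: "(nat \<Rightarrow> nat) \<Rightarrow> bool" where
  "is_partition \<nu> \<longleftrightarrow> \<nu> 0 = 0 \<and> (\<forall>i\<ge>1. \<nu> (Suc i) \<le> \<nu> i) \<and> finite {i. \<nu> i \<noteq> 0}"

definition plength :: "(nat \<Rightarrow> nat) \<Rightarrow> nat" where
  "plength \<nu> = card {i. \<nu> i \<noteq> 0}"

text \<open>Boxes are written (row, column), both counted from 1.\<close>

definition diagram :: "(nat \<Rightarrow> nat) \<Rightarrow> (nat \<times> nat) set" where
  "diagram \<nu> = {(i, j). 1 \<le> i \<and> 1 \<le> j \<and> j \<le> \<nu> i}"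

definition skew :: "(nat \<Rightarrow> nat) \<Rightarrow> (nat \<Rightarrow> nat) \<Rightarrow> (nat \<times> nat) set" where
  "skew \<eta> \<mu> = diagram \<eta> - diagram \<mu>"

definition is_skew_diagram :: "(nat \<times> nat) set \<Rightarrow> bool" where
  "is_skew_diagram S \<longleftrightarrow>
    (\<exists>\<eta> \<mu>. is_partition \<eta> \<and> is_partition \<mu> \<and> diagram \<mu> \<subseteq> diagram \<eta> \<and> S = skew \<eta> \<mu>)"

fun adjacent :: "nat \<times> nat \<Rightarrow> nat \<times> nat \<Rightarrow> bool" where
  "adjacent (i, j) (i', j') \<longleftrightarrow>
    (i = i' \<and> (j' = Suc j \<or> j = Suc j')) \<or> (j = j' \<and> (i' = Suc i \<or> i = Suc i'))"

definition boxes_connected :: "(nat \<times> nat) set \<Rightarrow> bool" where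
  "boxes_connected S \<longleftrightarrow>
    (\<forall>a\<in>S. \<forall>b\<in>S. (a, b) \<in> {(x, y). x \<in> S \<and> y \<in> S \<and> adjacent x y}\<^sup>*)"

definition border_strip :: "(nat \<times> nat) set \<Rightarrow> bool" where
  "border_strip S \<longleftrightarrow> is_skew_diagram S \<and> S \<noteq> {} \<and> boxes_connected S \<and>
    \<not> (\<exists>i j. {(i, j), (Suc i, j), (i, Suc j), (Suc i, Suc j)} \<subseteq> S)"

definition BS :: "nat \<Rightarrow> (nat \<times> nat) set set" where
  "BS r = {S. border_strip S \<and> card S = r}"

definition ht :: "(nat \<times> nat) set \<Rightarrow> nat" where
  "ht S = card (fst ` S) - 1"

text \<open>
  Library matrices are indexed from 0, hence the successors: the \<open>(i, j)\<close> entry for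
  \<open>1 \<le> i, j \<le> n\<close> is \<open>x\<^sub>i\<close> to the power \<open>a j\<close>, minus its inverse.
\<close>

definition alt_det :: "nat \<Rightarrow> (nat \<Rightarrow> nat) \<Rightarrow> ratfun" where
  "alt_det n a = det (mat n n (\<lambda>(i, j).
     indet (Suc i) ^ a (Suc j) - inverse (indet (Suc i)) ^ a (Suc j)))"

definition sp :: "nat \<Rightarrow> (nat \<Rightarrow> nat) \<Rightarrow> ratfun" where
  "sp n \<nu> =
    (if plength \<nu> \<le> n
     then alt_det n (\<lambda>j. \<nu> j + n - j + 1) / alt_det n (\<lambda>j. n - j + 1)
     else 0)"

definition delta :: "nat \<Rightarrow> nat \<Rightarrow> nat" where
  "delta n i = n + 1 - i"

definition m_index :: "nat \<Rightarrow> nat \<Rightarrow> (nat \<Rightarrow> nat) \<Rightarrow> nat" where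
  "m_index n r \<mu> =
    (if \<forall>i\<in>{1..n}. \<mu> i + delta n i < r then 0
     else Max {i \<in> {1..n}. r \<le> \<mu> i + delta n i})"

definition new_entry :: "nat \<Rightarrow> nat \<Rightarrow> (nat \<Rightarrow> nat) \<Rightarrow> nat \<Rightarrow> int" where
  "new_entry n r \<mu> q = int r - int (\<mu> q + delta n q)"

definition Delta :: "nat \<Rightarrow> nat \<Rightarrow> (nat \<Rightarrow> nat) \<Rightarrow> nat \<Rightarrow> int list" where
  "Delta n r \<mu> q = rev (sort (map
     (\<lambda>i. if i = q then new_entry n r \<mu> q else int (\<mu> i + delta n i)) [1..<Suc n]))"

definition collision :: "nat \<Rightarrow> nat \<Rightarrow> (nat \<Rightarrow> nat) \<Rightarrow> nat \<Rightarrow> bool" where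
  "collision n r \<mu> q \<longleftrightarrow> (\<exists>j\<in>{1..n}. j \<noteq> q \<and> new_entry n r \<mu> q = int (\<mu> j + delta n j))"

text \<open>
  For \<open>m_index n r \<mu> < q \<le> n\<close> and without a collision, the entries of \<open>Delta n r \<mu> q\<close> are distinct
  and positive, so the argument of \<open>nat\<close> below is nonnegative.
\<close>

definition mu_q :: "nat \<Rightarrow> nat \<Rightarrow> (nat \<Rightarrow> nat) \<Rightarrow> nat \<Rightarrow> nat \<Rightarrow> nat" where
  "mu_q n r \<mu> q i =
    (if 1 \<le> i \<and> i \<le> n then nat (Delta n r \<mu> q ! (i - 1) - int (delta n i)) else 0)"

definition sp_mu_q :: "nat \<Rightarrow> nat \<Rightarrow> (nat \<Rightarrow> nat) \<Rightarrow> nat \<Rightarrow> ratfun" where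
  "sp_mu_q n r \<mu> q = (if collision n r \<mu> q then 0 else sp n (mu_q n r \<mu> q))"

text \<open>
  The position is counted from 1.  It is unspecified in the case of a collision, where it
  is only ever multiplied by \<open>sp_mu_q n r \<mu> q = 0\<close>.
\<close>

definition p_index :: "nat \<Rightarrow> nat \<Rightarrow> (nat \<Rightarrow> nat) \<Rightarrow> nat \<Rightarrow> nat" where
  "p_index n r \<mu> q =
    (THE p. p \<in> {1..n} \<and> Delta n r \<mu> q ! (p - 1) = new_entry n r \<mu> q)"

end

theory Submission
  imports Defs
begin

text \<open>
  Put \<open>a i = \<mu> i + n + 1 - i\<close>, a strictly decreasing sequence of \<open>n\<close> positive integers.  Then
  \<open>sp n \<mu>\<close> is the alternant of \<open>a\<close>, that is \<open>det (x\<^sub>i powi a j - x\<^sub>i powi (- a j))\<close>, divided by a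
  denominator that does not depend on \<open>\<mu>\<close>, and the theorem is an identity between alternants.

  Multiplication by \<open>x\<^sub>i powi r + x\<^sub>i powi (- r)\<close> turns an entry of row \<open>i\<close> with exponent \<open>k\<close>
  into the sum of the entries with exponents \<open>k + r\<close> and \<open>k - r\<close>.  Laplace expansion along
  rows and then along columns shows that \<open>pbar n r\<close> times the alternant of \<open>a\<close> is the sum, over all positions \<open>q\<close>, of the alternants of \<open>a\<close> with the single
  entry \<open>a q\<close> replaced by \<open>a q + r\<close> and by \<open>a q - r\<close> (\<open>pbar_times_alternant\<close>).  It remains to sort
  the new sequences.  An alternant changes sign under a transposition of entries and under negation
  of an entry, and it vanishes if two entries agree or an entry is zero.  Carrying an entry from
  position \<open>q\<close> to position \<open>p\<close> costs \<open>\<bar>p - q\<bar>\<close> transpositions (\<open>alternant_move\<close>).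

  In terms of partitions, raising an entry by \<open>r\<close> and sorting is the same as adding a border strip with
  \<open>r\<close> boxes: if the entry travels from \<open>q\<close> to \<open>p\<close>, the strip occupies the rows \<open>p, \<dots>, q\<close>, so
  that its height \<open>q - p\<close> is the number of transpositions (\<open>border_strip_iff_ribbon\<close>,
  \<open>ribbon_iff_move\<close>).  This gives the first sum.  Lowering an entry \<open>a q > r\<close> is the inverse
  operation, the removal of a strip, and gives the second sum; \<open>a q = r\<close> contributes 0.
  If \<open>a q < r\<close>, that is \<open>q > m_index n r \<mu>\<close>, the lowered entry is negative; replacing it by \<open>r - a q\<close> costs the additional
  sign in the third sum.
\<close>

section \<open>Alternants with integer exponents\<close>

lemma indet_nonzero: "indet i \<noteq> 0"
proof -
  have "Poly_Mapping.single (Poly_Mapping.single i 1) (1::int) \<noteq> (0 :: (nat \<Rightarrow>\<^sub>0 nat) \<Rightarrow>\<^sub>0 int)"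
    by (metis lookup_single_eq lookup_zero zero_neq_one)
  then show ?thesis
    by (simp add: indet_def Zero_fract_def eq_fract)
qed

text \<open>
  The exponents are integers rather than natural numbers because lowering an entry by \<open>r\<close> can make
  it negative.  Entries are indexed from 1, matrix columns from 0.
\<close>

definition alternant :: "nat \<Rightarrow> (nat \<Rightarrow> int) \<Rightarrow> ratfun" where
  "alternant n a = det (mat n n (\<lambda>(i, j).
     indet (Suc i) powi a (Suc j) - indet (Suc i) powi (- a (Suc j))))"

lemma alternant_cong:
  assumes "\<And>j. j \<in> {1..n} \<Longrightarrow> a j = b j"
  shows "alternant n a = alternant n b"
  unfolding alternant_def
  by (rule arg_cong[where f = det], rule cong_mat) (auto simp: assms)

lemma alt_det_eq_alternant: "alt_det n a = alternant n (\<lambda>j. int (a j))"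
  unfolding alternant_def alt_det_def
  by (rule arg_cong[where f = det], rule cong_mat)
     (auto simp: power_int_minus power_inverse)

text \<open>
  The cofactors along a column do not see that column, so the determinant is linear in it.  All
  single-column identities for alternants below are read off from this expansion.
\<close>

lemma det_replaced_column:
  fixes f :: "nat \<Rightarrow> nat \<Rightarrow> 'a :: comm_ring_1"
  assumes "q < n"
  shows "det (mat n n (\<lambda>(i, j). if j = q then u i else f i j)) =
    (\<Sum>i<n. u i * cofactor (mat n n (\<lambda>(i, j). f i j)) i q)"
proof -
  let ?A = "mat n n (\<lambda>(i, j). if j = q then u i else f i j)"
  have "mat_delete ?A i q = mat_delete (mat n n (\<lambda>(i, j). f i j)) i q" if "i < n" for i
    using that assms by (intro eq_matI) (auto simp: mat_delete_def)
  then have "cofactor ?A i q = cofactor (mat n n (\<lambda>(i, j). f i j)) i q" if "i < n" for i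
    using that by (simp add: cofactor_def)
  then show ?thesis
    using assms by (subst laplace_expansion_column[of _ n q]) auto
qed

text \<open>
  Expanding the \<open>q\<close>-th determinant on the right along its changed column produces
  \<open>y i * f i q\<close> times a cofactor of the original matrix; for fixed \<open>i\<close> the sum over \<open>q\<close> is the
  expansion of the original determinant along row \<open>i\<close>.
\<close>

lemma sum_det_scaled_columns:
  fixes f :: "nat \<Rightarrow> nat \<Rightarrow> 'a :: comm_ring_1"
  shows "(\<Sum>i<n. y i) * det (mat n n (\<lambda>(i, j). f i j)) =
    (\<Sum>q<n. det (mat n n (\<lambda>(i, j). if j = q then y i * f i q else f i j)))"
proof -
  let ?F = "mat n n (\<lambda>(i, j). f i j)"
  have "(\<Sum>q<n. det (mat n n (\<lambda>(i, j). if j = q then y i * f i q else f i j))) =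
      (\<Sum>q<n. \<Sum>i<n. (y i * f i q) * cofactor ?F i q)"
    by (intro sum.cong refl, subst det_replaced_column) auto
  also have "\<dots> = (\<Sum>i<n. y i * (\<Sum>q<n. f i q * cofactor ?F i q))"
    by (subst sum.swap) (simp add: sum_distrib_left mult.assoc)
  also have "\<dots> = (\<Sum>i<n. y i * det ?F)"
    by (intro sum.cong refl, subst laplace_expansion_row[of ?F n]) auto
  finally show ?thesis by (simp add: sum_distrib_right)
qed

lemma power_sum_times_alternating_entry:
  fixes x :: "'a :: field"
  assumes "x \<noteq> 0"
  shows "(x ^ r + inverse x ^ r) * (x powi k - x powi (- k)) =
    (x powi (k + int r) - x powi (- (k + int r))) +
    (x powi (k - int r) - x powi (- (k - int r)))"
proof -
  have e: "x ^ r = x powi int r" "inverse x ^ r = x powi (- int r)"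
    by (simp_all add: power_int_minus power_inverse)
  have n: "- (k + int r) = - k + - int r" "- (k + - int r) = - k + int r"
    "k - int r = k + - int r" by simp_all
  show ?thesis
    unfolding e n power_int_add[OF disjI1[OF assms]] by (simp only: algebra_simps)
qed

lemma alternant_update:
  assumes "q < n"
  shows "alternant n (a(Suc q := k)) = det (mat n n (\<lambda>(i, j). if j = q
      then indet (Suc i) powi k - indet (Suc i) powi (- k)
      else indet (Suc i) powi a (Suc j) - indet (Suc i) powi (- a (Suc j))))"
  unfolding alternant_def by (rule arg_cong[where f = det], rule cong_mat) auto

lemma pbar_times_alternant:
  "pbar n r * alternant n a =
    (\<Sum>q=1..n. alternant n (a(q := a q + int r)) + alternant n (a(q := a q - int r)))"
proof -
  let ?e = "\<lambda>i k. indet (Suc i) powi k - indet (Suc i) powi (- k)"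
  let ?y = "\<lambda>i. indet (Suc i) ^ r + inverse (indet (Suc i)) ^ r"
  have "pbar n r = (\<Sum>i<n. ?y i)"
    unfolding pbar_def by (simp add: sum.atLeast1_atMost_eq)
  then have "pbar n r * alternant n a =
      (\<Sum>q<n. det (mat n n (\<lambda>(i, j). if j = q then ?y i * ?e i (a (Suc q)) else ?e i (a (Suc j)))))"
    unfolding alternant_def by (simp only: sum_det_scaled_columns)
  also have "\<dots> = (\<Sum>q<n. alternant n (a(Suc q := a (Suc q) + int r)) +
      alternant n (a(Suc q := a (Suc q) - int r)))"
  proof (rule sum.cong[OF refl])
    fix q assume "q \<in> {..<n}"
    then have q: "q < n" by simp
    show "det (mat n n (\<lambda>(i, j). if j = q then ?y i * ?e i (a (Suc q)) else ?e i (a (Suc j)))) =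
      alternant n (a(Suc q := a (Suc q) + int r)) + alternant n (a(Suc q := a (Suc q) - int r))"
      unfolding alternant_update[OF q] det_replaced_column[OF q]
        power_sum_times_alternating_entry[OF indet_nonzero]
      by (simp only: distrib_right sum.distrib)
  qed
  finally show ?thesis by (simp add: sum.atLeast1_atMost_eq)
qed

text \<open>
  The column of an exponent \<open>k\<close> consists of differences \<open>x powi k - x powi (- k)\<close>, which are odd in
  \<open>k\<close>.
\<close>

lemma alternant_negated_entry:
  assumes "q \<in> {1..n}"
  shows "alternant n (a(q := - k)) = - alternant n (a(q := k))"
proof -
  obtain q' where q: "q = Suc q'" "q' < n" using assms by (cases q) auto
  show ?thesis
    unfolding q(1) alternant_update[OF q(2)] det_replaced_column[OF q(2)] sum_negf[symmetric]
    by (intro sum.cong refl) (simp add: algebra_simps)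
qed

lemma alternant_zero_entry:
  assumes "q \<in> {1..n}"
  shows "alternant n (a(q := 0)) = 0"
proof -
  obtain q' where q: "q = Suc q'" "q' < n" using assms by (cases q) auto
  show ?thesis
    unfolding q(1) alternant_update[OF q(2)] det_replaced_column[OF q(2)] by simp
qed

lemma alternant_equal_entries:
  assumes "i \<in> {1..n}" "j \<in> {1..n}" "i \<noteq> j" "a i = a j"
  shows "alternant n a = 0"
proof -
  obtain i' j' where "i = Suc i'" "i' < n" "j = Suc j'" "j' < n"
    using assms by (cases i; cases j) auto
  then show ?thesis
    unfolding alternant_def using assms
    by (intro det_identical_columns[of _ n i' j']) (auto intro!: eq_vecI)
qed

lemma alternant_swap_adjacent:
  assumes "1 \<le> q" "q < n"
  shows "alternant n (a \<circ> transpose q (Suc q)) = - alternant n a"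
proof -
  obtain q' where q: "q = Suc q'" using assms by (cases q) auto
  let ?M = "mat n n (\<lambda>(i, j). indet (Suc i) powi a (Suc j) - indet (Suc i) powi (- a (Suc j)))"
  have "alternant n (a \<circ> transpose q (Suc q)) = det (swapcols q' (Suc q') ?M)"
    unfolding alternant_def
    by (rule arg_cong[where f = det], rule eq_matI)
       (use assms in \<open>auto simp: q Transposition.transpose_def mat_swapcols_def\<close>)
  also have "\<dots> = - det ?M"
    using assms by (intro det_swapcols[of _ n]) (auto simp: q)
  finally show ?thesis by (simp add: alternant_def)
qed

text \<open>
  The cyclic shift that takes the entry at position \<open>q\<close> out and reinserts it at the earlier position
  \<open>p\<close>.  Moves to a later position are expressed by exchanging the roles of the old and the new
  sequence.
\<close>

definition move :: "nat \<Rightarrow> nat \<Rightarrow> (nat \<Rightarrow> 'a) \<Rightarrow> nat \<Rightarrow> 'a" where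
  "move p q a i = (if i = p then a q else if p < i \<and> i \<le> q then a (i - 1) else a i)"

lemma move_refl [simp]: "move p p a = a"
  by (auto simp: move_def)

text \<open>
  A move by \<open>q - p\<close> positions is a product of \<open>q - p\<close> adjacent transpositions.
\<close>

lemma alternant_move:
  assumes "1 \<le> p" "p \<le> q" "q \<le> n"
  shows "alternant n (move p q a) = (-1) ^ (q - p) * alternant n a"
  using assms(2,3)
proof (induction q arbitrary: a rule: dec_induct)
  case base
  then show ?case by simp
next
  case (step q)
  have "move p (Suc q) a = move p q (a \<circ> transpose q (Suc q))"
    using step.hyps by (auto simp: move_def Transposition.transpose_def fun_eq_iff)
  then have "alternant n (move p (Suc q) a) =
      (-1) ^ (q - p) * alternant n (a \<circ> transpose q (Suc q))"
    using step by simp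
  also have "\<dots> = (-1) ^ (Suc q - p) * alternant n a"
    using step assms(1) by (simp add: alternant_swap_adjacent Suc_diff_le)
  finally show ?case .
qed

section \<open>Sorting a sequence after changing one entry\<close>

definition decreasing :: "nat \<Rightarrow> (nat \<Rightarrow> int) \<Rightarrow> bool" where
  "decreasing n a \<longleftrightarrow> (\<forall>i j. 1 \<le> i \<longrightarrow> i < j \<longrightarrow> j \<le> n \<longrightarrow> a j < a i)"

lemma decreasingD: "decreasing n a \<Longrightarrow> 1 \<le> i \<Longrightarrow> i < j \<Longrightarrow> j \<le> n \<Longrightarrow> a j < a i"
  by (simp add: decreasing_def)

lemma decreasing_le: "decreasing n a \<Longrightarrow> 1 \<le> i \<Longrightarrow> i \<le> j \<Longrightarrow> j \<le> n \<Longrightarrow> a j \<le> a i"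
  by (metis decreasingD le_neq_implies_less less_imp_le order_refl)

lemma decreasing_inj_on: "decreasing n a \<Longrightarrow> inj_on a {1..n}"
  by (rule linorder_inj_onI) (auto dest: decreasingD)

text \<open>
  Multisets of entries are compared, instead of asking for a permutation of the positions, because
  the sorted list is characterised by its multiset and transitivity is immediate.
\<close>

definition rearrangement :: "nat \<Rightarrow> (nat \<Rightarrow> 'a) \<Rightarrow> (nat \<Rightarrow> 'a) \<Rightarrow> bool" where
  "rearrangement n b a \<longleftrightarrow> image_mset b (mset_set {1..n}) = image_mset a (mset_set {1..n})"

lemma rearrangement_sym: "rearrangement n b a \<Longrightarrow> rearrangement n a b"
  by (simp add: rearrangement_def)

lemma rearrangement_trans: "rearrangement n c b \<Longrightarrow> rearrangement n b a \<Longrightarrow> rearrangement n c a"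
  by (simp add: rearrangement_def)

lemma rearrangement_cong: "(\<And>i. i \<in> {1..n} \<Longrightarrow> b i = a i) \<Longrightarrow> rearrangement n b a"
  unfolding rearrangement_def by (rule image_mset_cong) simp

lemma rearrangement_image:
  assumes "rearrangement n b a"
  shows "b ` {1..n} = a ` {1..n}"
proof -
  have "set_mset (image_mset b (mset_set {1..n})) = set_mset (image_mset a (mset_set {1..n}))"
    using assms unfolding rearrangement_def by (rule arg_cong)
  then show ?thesis by simp
qed

lemma rev_sort_decreasing:
  assumes "decreasing n b" "rearrangement n b a"
  shows "rev (sort (map a [1..<Suc n])) = map b [1..<Suc n]"
proof -
  have "sorted (rev (map b [1..<Suc n]))"
    unfolding sorted_rev_iff_nth_mono
    using assms(1) by (auto intro!: decreasing_le[of n] simp del: upt_Suc)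
  moreover have upt: "mset [1..<Suc n] = mset_set {1..n}"
    by (metis mset_upt atLeastLessThanSuc_atLeastAtMost)
  have "mset (map b [1..<Suc n]) = mset (map a [1..<Suc n])"
    using assms(2) unfolding mset_map upt rearrangement_def .
  ultimately have "sort (map a [1..<Suc n]) = rev (map b [1..<Suc n])"
    by (intro properties_for_sort) simp_all
  then show ?thesis by simp
qed

lemma decreasing_rearrangement_unique:
  assumes "decreasing n b" "decreasing n b'" "rearrangement n b b'" "i \<in> {1..n}"
  shows "b i = b' i"
proof -
  have "map b [1..<Suc n] = map b' [1..<Suc n]"
    using rev_sort_decreasing[OF assms(1,3)]
      rev_sort_decreasing[OF assms(2), of b'] by (simp only: rearrangement_def)
  then show ?thesis using assms(4) by (simp add: map_eq_conv del: upt_Suc)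
qed

lemma rearrangement_move:
  assumes "1 \<le> p" "p \<le> q" "q \<le> n"
  shows "rearrangement n (move p q a) a"
proof -
  \<comment> \<open>\<open>c\<close> is the cyclic permutation of positions that underlies the move.\<close>
  define c where "c i = (if i = p then q else if p < i \<and> i \<le> q then i - 1 else i)" for i
  have inj: "inj_on c {1..n}"
    using assms by (auto simp: c_def inj_on_def split: if_splits)
  have "c ` {1..n} \<subseteq> {1..n}"
    using assms by (auto simp: c_def)
  then have "c ` {1..n} = {1..n}"
    using inj by (intro endo_inj_surj) simp_all
  then have "image_mset c (mset_set {1..n}) = mset_set {1..n}"
    using image_mset_mset_set[OF inj] by simp
  then have "image_mset (a \<circ> c) (mset_set {1..n}) = image_mset a (mset_set {1..n})"
    by (simp flip: image_mset.compositionality)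
  moreover have "a \<circ> c = move p q a"
    by (auto simp: fun_eq_iff move_def c_def)
  ultimately show ?thesis by (simp only: rearrangement_def)
qed

text \<open>
  After an entry of a strictly decreasing sequence is replaced by a larger value that does not occur
  elsewhere, moving it to the left, in front of the first entry not exceeding it, restores
  strict monotonicity.
\<close>

lemma insert_larger_entry:
  assumes a: "decreasing n a" and q: "q \<in> {1..n}" and v: "a q \<le> v"
    and fresh: "\<And>j. j \<in> {1..n} \<Longrightarrow> j \<noteq> q \<Longrightarrow> a j \<noteq> v"
  obtains p where "1 \<le> p" "p \<le> q" "decreasing n (move p q (a(q := v)))"
proof -
  let ?P = "\<lambda>i. 1 \<le> i \<and> a i \<le> v"
  define p where "p = (LEAST i. ?P i)"
  have Pq: "?P q" using q v by simp
  have p: "?P p" "p \<le> q"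
    unfolding p_def by (rule LeastI[of ?P, OF Pq], rule Least_le[of ?P, OF Pq])
  have above: "v < a i" if "1 \<le> i" "i < p" for i
    using not_less_Least[of i ?P] that by (auto simp: p_def)
  have below: "a i < v" if "p \<le> i" "i < q" for i
    using decreasing_le[OF a, of p i] fresh[of i] p q that by force
  have below': "a i < v" if "q < i" "i \<le> n" for i
    using decreasingD[OF a, of q i] q v that by force
  have "decreasing n (move p q (a(q := v)))"
    unfolding decreasing_def
  proof (intro allI impI)
    fix i j assume ij: "1 \<le> i" "i < j" "j \<le> n"
    show "move p q (a(q := v)) j < move p q (a(q := v)) i"
      using p q ij above[of i] below[of "j - 1"] below'[of j] decreasingD[OF a, of i j]
        decreasingD[OF a, of i "j - 1"] decreasingD[OF a, of "i - 1" j]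
        decreasingD[OF a, of "i - 1" "j - 1"]
      by (auto simp: move_def)
  qed
  then show thesis using that p by blast
qed

text \<open>
  The counterpart for a smaller value, which has to travel to the right.  The sorted sequence \<open>b\<close> is
  described implicitly: undoing the sorting is a move to the left.
\<close>

lemma insert_smaller_entry:
  assumes a: "decreasing n a" and q: "q \<in> {1..n}" and v: "v \<le> a q"
    and fresh: "\<And>j. j \<in> {1..n} \<Longrightarrow> j \<noteq> q \<Longrightarrow> a j \<noteq> v"
  obtains p b where "q \<le> p" "p \<le> n" "decreasing n b" "a(q := v) = move q p b"
proof -
  let ?P = "\<lambda>i. i \<le> n \<and> v \<le> a i"
  define p where "p = (GREATEST i. ?P i)"
  have Pq: "?P q" using q v by simp
  have p: "?P p" "q \<le> p"
    unfolding p_def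
    by (rule GreatestI_nat[of ?P, OF Pq, where b = n], simp,
        rule Greatest_le_nat[of ?P, OF Pq, where b = n], simp)
  have below: "a i < v" if "p < i" "i \<le> n" for i
    using Greatest_le_nat[of ?P i n] that by (fastforce simp: p_def)
  have above: "v < a i" if "q < i" "i \<le> p" for i
    using decreasing_le[OF a, of i p] fresh[of i] p q that by force
  have above': "v < a i" if "1 \<le> i" "i < q" for i
    using decreasingD[OF a, of i q] q v that by force
  define b where "b = (\<lambda>i. if i = p then v else if q \<le> i \<and> i < p then a (Suc i) else a i)"
  have "decreasing n b"
    unfolding decreasing_def
  proof (intro allI impI)
    fix i j assume ij: "1 \<le> i" "i < j" "j \<le> n"
    show "b j < b i"
      using p q ij above[of "Suc i"] above'[of i] below[of j] decreasingD[OF a, of i j]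
        decreasingD[OF a, of i "Suc j"] decreasingD[OF a, of "Suc i" j]
        decreasingD[OF a, of "Suc i" "Suc j"]
      by (auto simp: b_def)
  qed
  moreover have "a(q := v) = move q p b"
    using p q by (auto simp: b_def move_def fun_eq_iff)
  ultimately show thesis using that p by blast
qed

section \<open>Partitions as strictly decreasing sequences\<close>

text \<open>
  The sequence \<open>\<mu> + \<delta>\<close> of the exponents in the numerator of the symplectic Schur polynomial.
\<close>

definition shifted :: "nat \<Rightarrow> (nat \<Rightarrow> nat) \<Rightarrow> nat \<Rightarrow> int" where
  "shifted n \<nu> i = int (\<nu> i + delta n i)"

lemma partition_antimono:
  assumes "is_partition \<nu>" "1 \<le> i" "i \<le> j"
  shows "\<nu> j \<le> \<nu> i"
  using assms(3)
proof (induction j rule: dec_induct)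
  case (step j)
  then show ?case using assms(1,2) unfolding is_partition_def by (meson le_trans)
qed simp

lemma partition_support:
  assumes "is_partition \<nu>"
  shows "{i. \<nu> i \<noteq> 0} = {1..plength \<nu>}"
proof -
  let ?S = "{i. \<nu> i \<noteq> 0}"
  have fin: "finite ?S" and "0 \<notin> ?S"
    using assms by (simp_all add: is_partition_def)
  have down: "{1..i} \<subseteq> ?S" if "i \<in> ?S" for i
    using partition_antimono[OF assms, of _ i] that by fastforce
  obtain m where "?S = {1..m}"
  proof (cases "?S = {}")
    case False
    have "Max ?S \<in> ?S" using Max_in[OF fin False] .
    moreover have "i \<in> {1..Max ?S}" if "i \<in> ?S" for i
      using Max_ge[OF fin that] that \<open>0 \<notin> ?S\<close> by (cases i) auto
    ultimately show ?thesis using down[of "Max ?S"] that by blast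
  qed (use that[of 0] in simp)
  then show ?thesis unfolding plength_def by simp
qed

lemma plength_le_iff:
  assumes "is_partition \<nu>"
  shows "plength \<nu> \<le> n \<longleftrightarrow> (\<forall>i>n. \<nu> i = 0)"
proof
  show "\<forall>i>n. \<nu> i = 0" if le: "plength \<nu> \<le> n"
  proof (intro allI impI)
    fix i assume "n < i"
    then have "i \<notin> {i. \<nu> i \<noteq> 0}" using le unfolding partition_support[OF assms] by simp
    then show "\<nu> i = 0" by simp
  qed
  show "plength \<nu> \<le> n" if "\<forall>i>n. \<nu> i = 0"
  proof (rule ccontr)
    assume "\<not> plength \<nu> \<le> n"
    then have "plength \<nu> \<in> {i. \<nu> i \<noteq> 0}" "\<nu> (plength \<nu>) = 0"
      using that unfolding partition_support[OF assms] by auto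
    then show False by blast
  qed
qed

lemma decreasing_shifted:
  assumes "is_partition \<nu>"
  shows "decreasing n (shifted n \<nu>)"
  unfolding decreasing_def
proof (intro allI impI)
  fix i j assume "1 \<le> i" "i < j" "j \<le> n"
  then show "shifted n \<nu> j < shifted n \<nu> i"
    using partition_antimono[OF assms, of i j] by (simp add: shifted_def delta_def)
qed

lemma partition_eqI:
  assumes "is_partition \<nu>" "plength \<nu> \<le> n" "is_partition \<nu>'" "plength \<nu>' \<le> n"
    and "\<And>i. i \<in> {1..n} \<Longrightarrow> shifted n \<nu> i = shifted n \<nu>' i"
  shows "\<nu> = \<nu>'"
proof
  fix i
  show "\<nu> i = \<nu>' i"
  proof (cases "i \<in> {1..n}")
    case True
    then show ?thesis using assms(5) by (simp add: shifted_def)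
  next
    case False
    then have "i = 0 \<or> n < i" by auto
    then show ?thesis using assms(1-4) by (auto simp: plength_le_iff is_partition_def)
  qed
qed

lemma shifted_pos: "i \<in> {1..n} \<Longrightarrow> 0 < shifted n \<nu> i"
  by (auto simp: shifted_def delta_def)

text \<open>
  The quotient that defines \<open>sp\<close> has a denominator independent of \<open>\<nu>\<close>, so that identities
  between symplectic Schur polynomials reduce to identities between numerators.
\<close>

lemma sp_eq_alternant:
  "sp n \<nu> = (if plength \<nu> \<le> n
     then alternant n (shifted n \<nu>) / alternant n (\<lambda>i. int (delta n i)) else 0)"
proof -
  have "alt_det n (\<lambda>j. \<nu> j + n - j + 1) = alternant n (shifted n \<nu>)"
    unfolding alt_det_eq_alternant
    by (rule alternant_cong) (auto simp: shifted_def delta_def)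
  moreover have "alt_det n (\<lambda>j. n - j + 1) = alternant n (\<lambda>i. int (delta n i))"
    unfolding alt_det_eq_alternant
    by (rule alternant_cong) (auto simp: delta_def)
  ultimately show ?thesis by (simp add: sp_def)
qed

text \<open>
  The inverse of \<open>shifted n\<close> on strictly decreasing sequences of positive numbers.  The value 0
  outside \<open>1, \<dots>, n\<close> makes the result a partition with the required normalisation at index 0.
\<close>

definition unshifted :: "nat \<Rightarrow> (nat \<Rightarrow> int) \<Rightarrow> nat \<Rightarrow> nat" where
  "unshifted n b i = (if i \<in> {1..n} then nat (b i - int (delta n i)) else 0)"

text \<open>
  Downward induction from the last entry, which is at least 1: every step to the left gains at least 1.
\<close>

lemma decreasing_ge_delta:
  assumes "decreasing n b" "\<And>i. i \<in> {1..n} \<Longrightarrow> 0 < b i" "i \<in> {1..n}"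
  shows "int (delta n i) \<le> b i"
proof -
  have "i \<le> n" "1 \<le> i" using assms(3) by auto
  then show ?thesis
  proof (induction i rule: inc_induct)
    case base
    then show ?case using assms(2)[of n] by (simp add: delta_def)
  next
    case (step i)
    then show ?case using decreasingD[OF assms(1), of i "Suc i"] by (auto simp: delta_def)
  qed
qed

lemma shifted_unshifted:
  assumes "decreasing n b" "\<And>i. i \<in> {1..n} \<Longrightarrow> 0 < b i" "i \<in> {1..n}"
  shows "shifted n (unshifted n b) i = b i"
  using decreasing_ge_delta[OF assms] assms(3) by (simp add: shifted_def unshifted_def)

lemma partition_unshifted:
  assumes "decreasing n b"
  shows "is_partition (unshifted n b)" "plength (unshifted n b) \<le> n"
proof -
  have "unshifted n b (Suc i) \<le> unshifted n b i" if "1 \<le> i" for i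
    using decreasingD[OF assms, of i "Suc i"] that
    by (auto simp: unshifted_def delta_def)
  moreover have "finite {i. unshifted n b i \<noteq> 0}"
    by (rule finite_subset[of _ "{1..n}"]) (auto simp: unshifted_def)
  ultimately show p: "is_partition (unshifted n b)"
    by (auto simp: is_partition_def unshifted_def)
  show "plength (unshifted n b) \<le> n"
    unfolding plength_le_iff[OF p] by (simp add: unshifted_def)
qed

section \<open>Border strips\<close>

lemma mem_skew: "(i, j) \<in> skew \<eta> \<mu> \<longleftrightarrow> 1 \<le> i \<and> \<mu> i < j \<and> j \<le> \<eta> i"
  by (auto simp: skew_def diagram_def)

lemma diagram_subset_iff: "diagram \<mu> \<subseteq> diagram \<eta> \<longleftrightarrow> (\<forall>i\<ge>1. \<mu> i \<le> \<eta> i)"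
proof
  assume sub: "diagram \<mu> \<subseteq> diagram \<eta>"
  show "\<forall>i\<ge>1. \<mu> i \<le> \<eta> i"
  proof (intro allI impI)
    fix i :: nat assume "1 \<le> i"
    then have "\<mu> i = 0 \<or> (i, \<mu> i) \<in> diagram \<eta>"
      using subsetD[OF sub, of "(i, \<mu> i)"] by (cases "\<mu> i = 0") (auto simp: diagram_def)
    then show "\<mu> i \<le> \<eta> i" by (auto simp: diagram_def)
  qed
next
  assume "\<forall>i\<ge>1. \<mu> i \<le> \<eta> i"
  then show "diagram \<mu> \<subseteq> diagram \<eta>"
    unfolding diagram_def by (auto dest: order_trans)
qed

text \<open>
  A numerical description of the border strips that occupy exactly the rows \<open>p, \<dots>, q\<close>: the row
  \<open>i + 1\<close> of the strip ends in the column \<open>\<mu> i + 1\<close> in which the row \<open>i\<close> begins.  If it ended further to the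
  left, the strip would be disconnected; if it ended further to the right, there would be a \<open>2\<times>2\<close> block.
  The length of row \<open>p\<close> is not determined by this condition; it is fixed by the number of boxes.
\<close>

definition ribbon :: "nat \<Rightarrow> nat \<Rightarrow> (nat \<Rightarrow> nat) \<Rightarrow> (nat \<Rightarrow> nat) \<Rightarrow> bool" where
  "ribbon p q \<mu> \<eta> \<longleftrightarrow> 1 \<le> p \<and> p \<le> q \<and> \<mu> p < \<eta> p \<and>
    (\<forall>i. i \<notin> {p..q} \<longrightarrow> \<eta> i = \<mu> i) \<and> (\<forall>i\<in>{p..<q}. \<eta> (Suc i) = Suc (\<mu> i))"

lemma ribbon_row:
  assumes "is_partition \<mu>" "ribbon p q \<mu> \<eta>" "i \<in> {p..q}"
  shows "\<mu> i < \<eta> i"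
proof (cases "i = p")
  case False
  then obtain k where "i = Suc k" "k \<in> {p..<q}" using assms(3) by (cases i) auto
  then show ?thesis
    using assms partition_antimono[OF assms(1), of k i] by (auto simp: ribbon_def)
qed (use assms in \<open>simp add: ribbon_def\<close>)

lemma ribbon_changed_rows:
  assumes "is_partition \<mu>" "ribbon p q \<mu> \<eta>"
  shows "{i. \<eta> i \<noteq> \<mu> i} = {p..q}"
proof -
  have "\<eta> i \<noteq> \<mu> i \<longleftrightarrow> i \<in> {p..q}" for i
    using ribbon_row[OF assms, of i] assms(2) unfolding ribbon_def by (cases "i \<in> {p..q}") auto
  then show ?thesis by blast
qed

lemma ribbon_rows_unique:
  assumes "is_partition \<mu>" "ribbon p q \<mu> \<eta>" "ribbon p' q' \<mu> \<eta>"
  shows "p = p'" "q = q'"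
proof -
  have "{p..q} = {p'..q'}"
    using ribbon_changed_rows assms by blast
  moreover have "p \<le> q" using assms(2) by (simp add: ribbon_def)
  ultimately show "p = p'" "q = q'" by (simp_all add: Icc_eq_Icc)
qed

lemma skew_ribbon:
  assumes "is_partition \<mu>" "ribbon p q \<mu> \<eta>"
  shows "skew \<eta> \<mu> = (SIGMA i:{p..q}. {\<mu> i<..\<eta> i})"
proof -
  have p: "1 \<le> p" using assms(2) by (simp add: ribbon_def)
  have rows: "i \<in> {p..q}" if "\<mu> i < j" "j \<le> \<eta> i" for i j
    unfolding ribbon_changed_rows[OF assms, symmetric] using that by simp
  have "(i, j) \<in> skew \<eta> \<mu> \<longleftrightarrow> (i, j) \<in> (SIGMA i:{p..q}. {\<mu> i<..\<eta> i})" for i j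
    using p rows[of i j] by (auto simp: mem_skew)
  then show ?thesis by (auto simp: set_eq_iff)
qed

lemma ht_ribbon:
  assumes "is_partition \<mu>" "ribbon p q \<mu> \<eta>"
  shows "ht (skew \<eta> \<mu>) = q - p"
proof -
  have "fst ` skew \<eta> \<mu> = {p..q}"
    unfolding skew_ribbon[OF assms]
    by (subst fst_image_Sigma) (use ribbon_row[OF assms] in auto)
  then show ?thesis by (simp add: ht_def)
qed

text \<open>
  The interlacing condition makes the sum of the row lengths \<open>\<eta> i - \<mu> i\<close> telescope.
\<close>

lemma card_skew_ribbon:
  assumes "is_partition \<mu>" "ribbon p q \<mu> \<eta>"
  shows "card (skew \<eta> \<mu>) + \<mu> q = \<eta> p + (q - p)"
proof -
  have "(\<Sum>i=p..m. \<eta> i - \<mu> i) + \<mu> m = \<eta> p + (m - p)" if "p \<le> m" "m \<le> q" for m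
    using that
  proof (induction m rule: dec_induct)
    case base
    then show ?case using assms(2) by (simp add: ribbon_def)
  next
    case (step m)
    have "\<eta> (Suc m) = Suc (\<mu> m)" using assms(2) step by (simp add: ribbon_def)
    moreover have "\<mu> (Suc m) < \<eta> (Suc m)" using ribbon_row[OF assms] step by simp
    ultimately show ?case using step by simp
  qed
  moreover have "card (skew \<eta> \<mu>) = (\<Sum>i=p..q. \<eta> i - \<mu> i)"
    unfolding skew_ribbon[OF assms] by simp
  ultimately show ?thesis using assms(2) by (simp add: ribbon_def)
qed

text \<open>
  Every box is joined to the first box of the last row: go left to the beginning of the row, where
  the next row ends directly below, step down, and repeat.
\<close>

lemma boxes_connected_ribbon:
  assumes "is_partition \<mu>" "ribbon p q \<mu> \<eta>"
  shows "boxes_connected (skew \<eta> \<mu>)"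
proof -
  let ?S = "skew \<eta> \<mu>"
  let ?R = "{(x, y). x \<in> ?S \<and> y \<in> ?S \<and> adjacent x y}"
  have adj: "((i, j), (i', j')) \<in> ?R\<^sup>*"
    if "(i, j) \<in> ?S" "(i', j') \<in> ?S" "adjacent (i, j) (i', j')" for i j i' j'
    using that by (intro r_into_rtrancl) simp
  have row: "((i, j), (i, Suc (\<mu> i))) \<in> ?R\<^sup>*" if "(i, j) \<in> ?S" for i j
  proof -
    have "Suc (\<mu> i) \<le> j" using that by (simp add: mem_skew)
    then show ?thesis using that
    proof (induction j rule: dec_induct)
      case (step j)
      then have "(i, j) \<in> ?S" by (simp add: mem_skew)
      then have "((i, j), (i, Suc (\<mu> i))) \<in> ?R\<^sup>*" by (rule step.IH)
      moreover have "((i, Suc j), (i, j)) \<in> ?R\<^sup>*"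
        using adj step.prems \<open>(i, j) \<in> ?S\<close> by simp
      ultimately show ?case by (rule rtrancl_trans[rotated])
    qed simp
  qed
  have "sym ?R"
    by (rule symI) (auto simp: adjacent.simps)
  then have sym: "sym (?R\<^sup>*)" by (rule sym_rtrancl)
  define c where "c = (q, Suc (\<mu> q))"
  have to_c: "((i, j), c) \<in> ?R\<^sup>*" if "(i, j) \<in> ?S" for i j
  proof -
    have "p \<le> i" "i \<le> q"
      using that unfolding skew_ribbon[OF assms] by auto
    from this(2,1) that show ?thesis
    proof (induction i arbitrary: j rule: inc_induct)
      case base
      then show ?case using row by (simp add: c_def)
    next
      case (step i)
      have eq: "\<eta> (Suc i) = Suc (\<mu> i)"
        using step assms(2) by (simp add: ribbon_def)
      have S: "(i, Suc (\<mu> i)) \<in> ?S" "(Suc i, Suc (\<mu> i)) \<in> ?S"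
        unfolding skew_ribbon[OF assms]
        using ribbon_row[OF assms, of i] ribbon_row[OF assms, of "Suc i"] step eq by auto
      have "((i, j), (i, Suc (\<mu> i))) \<in> ?R\<^sup>*" using row step by blast
      also have "((i, Suc (\<mu> i)), (Suc i, Suc (\<mu> i))) \<in> ?R\<^sup>*" using adj S by simp
      also have "((Suc i, Suc (\<mu> i)), c) \<in> ?R\<^sup>*" using step S by simp
      finally show ?case .
    qed
  qed
  have "(a, b) \<in> ?R\<^sup>*" if "a \<in> ?S" "b \<in> ?S" for a b
  proof -
    have "(a, c) \<in> ?R\<^sup>*" "(b, c) \<in> ?R\<^sup>*"
      using to_c[of "fst a" "snd a"] to_c[of "fst b" "snd b"] that by simp_all
    then show ?thesis using symD[OF sym, of b c] by (meson rtrancl_trans)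
  qed
  then show ?thesis unfolding boxes_connected_def by blast
qed

lemma border_strip_ribbon:
  assumes "is_partition \<mu>" "is_partition \<eta>" "ribbon p q \<mu> \<eta>"
  shows "diagram \<mu> \<subseteq> diagram \<eta>" "border_strip (skew \<eta> \<mu>)"
proof -
  note pq = assms(1,3)
  show sub: "diagram \<mu> \<subseteq> diagram \<eta>"
    unfolding diagram_subset_iff
  proof (intro allI impI)
    fix i
    show "\<mu> i \<le> \<eta> i"
      using ribbon_row[OF pq, of i] assms(3) unfolding ribbon_def by (cases "i \<in> {p..q}") auto
  qed
  have "is_skew_diagram (skew \<eta> \<mu>)"
    unfolding is_skew_diagram_def using assms sub by blast
  moreover have "(p, \<eta> p) \<in> skew \<eta> \<mu>"
    using assms(3) by (simp add: mem_skew ribbon_def)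
  moreover have False
    if "{(i, j), (Suc i, j), (i, Suc j), (Suc i, Suc j)} \<subseteq> skew \<eta> \<mu>" for i j
  proof -
    have "(i, j) \<in> skew \<eta> \<mu>" "(Suc i, Suc j) \<in> skew \<eta> \<mu>" using that by auto
    then have "i \<in> {p..<q}" "\<mu> i < j" "Suc j \<le> \<eta> (Suc i)"
      unfolding skew_ribbon[OF pq] by auto
    then show False using assms(3) by (simp add: ribbon_def)
  qed
  ultimately show "border_strip (skew \<eta> \<mu>)"
    unfolding border_strip_def using boxes_connected_ribbon[OF pq] by blast
qed

text \<open>
  A path of adjacent boxes changes its row by at most one in each step, so it can pass from the rows
  up to \<open>i\<close> to the rows below only through a vertical pair of boxes.
\<close>

lemma path_crosses_rows:
  assumes "(a, b) \<in> {(x, y). x \<in> S \<and> y \<in> S \<and> adjacent x y}\<^sup>*" "fst a \<le> i" "i < fst b"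
  shows "\<exists>j. (i, j) \<in> S \<and> (Suc i, j) \<in> S"
  using assms(1,3)
proof (induction rule: rtrancl_induct)
  case base
  then show ?case using assms(2) by simp
next
  case (step y z)
  show ?case
  proof (cases "i < fst y")
    case False
    obtain k j k' j' where "y = (k, j)" "z = (k', j')" by (metis prod.collapse)
    moreover from this have "k = i" "k' = Suc i" "j = j'"
      using step.hyps step.prems False by auto
    ultimately show ?thesis using step.hyps by auto
  qed (use step in blast)
qed

text \<open>
  Connectedness gives \<open>\<mu> i + 1 \<le> \<eta> (i + 1)\<close> for consecutive rows of the strip, and the absence of
  \<open>2\<times>2\<close> blocks gives the opposite inequality.
\<close>

lemma ribbon_of_border_strip:
  assumes part: "is_partition \<mu>" "is_partition \<eta>" and sub: "diagram \<mu> \<subseteq> diagram \<eta>"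
    and strip: "border_strip (skew \<eta> \<mu>)"
  obtains p q where "ribbon p q \<mu> \<eta>"
proof -
  let ?S = "skew \<eta> \<mu>"
  let ?I = "fst ` ?S"
  have I: "i \<in> ?I \<longleftrightarrow> 1 \<le> i \<and> \<mu> i < \<eta> i" for i
  proof
    assume "i \<in> ?I"
    then obtain j where "(i, j) \<in> ?S" by auto
    then show "1 \<le> i \<and> \<mu> i < \<eta> i" by (simp add: mem_skew)
  next
    assume "1 \<le> i \<and> \<mu> i < \<eta> i"
    then have "(i, \<eta> i) \<in> ?S" by (simp add: mem_skew)
    then show "i \<in> ?I" by (rule image_eqI[rotated]) simp
  qed
  have "?I \<subseteq> {i. \<eta> i \<noteq> 0}"
  proof
    fix i assume "i \<in> ?I"
    then show "i \<in> {i. \<eta> i \<noteq> 0}" unfolding I by simp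
  qed
  then have fin: "finite ?I"
    using part(2) finite_subset unfolding is_partition_def by blast
  have ne: "?I \<noteq> {}" using strip by (simp add: border_strip_def)
  define p q where "p = Min ?I" and "q = Max ?I"
  have p: "p \<in> ?I" and q: "q \<in> ?I" and bounds: "\<And>i. i \<in> ?I \<Longrightarrow> p \<le> i \<and> i \<le> q"
    unfolding p_def q_def using fin ne by (auto intro: Min_in Max_in)
  have out: "\<eta> i = \<mu> i" if "i \<notin> {p..q}" for i
  proof (cases "i = 0")
    case True
    then show ?thesis using part by (simp add: is_partition_def)
  next
    case False
    then have "i \<notin> ?I" "\<mu> i \<le> \<eta> i"
      using bounds that sub by (auto simp: diagram_subset_iff)
    then show ?thesis using False unfolding I by simp
  qed
  have interlace: "\<eta> (Suc i) = Suc (\<mu> i)" if i: "i \<in> {p..<q}" for i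
  proof (rule antisym)
    have i1: "1 \<le> i" using i p unfolding I by simp
    obtain a b where "a \<in> ?S" "b \<in> ?S" "fst a = p" "fst b = q" using p q by auto
    then have "\<exists>j. (i, j) \<in> ?S \<and> (Suc i, j) \<in> ?S"
      using strip i path_crosses_rows[of a b ?S i]
      unfolding border_strip_def boxes_connected_def by force
    then show "Suc (\<mu> i) \<le> \<eta> (Suc i)" by (auto simp: mem_skew)
    show "\<eta> (Suc i) \<le> Suc (\<mu> i)"
    proof (rule ccontr)
      assume "\<not> ?thesis"
      moreover have "\<eta> (Suc i) \<le> \<eta> i" "\<mu> (Suc i) \<le> \<mu> i"
        using part i1 by (auto simp: is_partition_def)
      ultimately have "{(i, Suc (\<mu> i)), (Suc i, Suc (\<mu> i)),
          (i, Suc (Suc (\<mu> i))), (Suc i, Suc (Suc (\<mu> i)))} \<subseteq> ?S"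
        using i1 by (simp add: mem_skew)
      then show False using strip unfolding border_strip_def by blast
    qed
  qed
  have "ribbon p q \<mu> \<eta>"
    unfolding ribbon_def using p bounds[OF q] out interlace I by auto
  then show thesis by (rule that)
qed

lemma border_strip_iff_ribbon:
  assumes "is_partition \<mu>" "is_partition \<eta>"
  shows "diagram \<mu> \<subseteq> diagram \<eta> \<and> skew \<eta> \<mu> \<in> BS r \<longleftrightarrow>
    (\<exists>p q. ribbon p q \<mu> \<eta> \<and> \<eta> p + (q - p) = \<mu> q + r)"
proof
  assume "diagram \<mu> \<subseteq> diagram \<eta> \<and> skew \<eta> \<mu> \<in> BS r"
  then have sub: "diagram \<mu> \<subseteq> diagram \<eta>" and "border_strip (skew \<eta> \<mu>)" "card (skew \<eta> \<mu>) = r"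
    by (simp_all add: BS_def)
  moreover obtain p q where "ribbon p q \<mu> \<eta>"
    using ribbon_of_border_strip[OF assms] calculation by blast
  ultimately show "\<exists>p q. ribbon p q \<mu> \<eta> \<and> \<eta> p + (q - p) = \<mu> q + r"
    using card_skew_ribbon[OF assms(1)] by (metis add.commute)
next
  assume "\<exists>p q. ribbon p q \<mu> \<eta> \<and> \<eta> p + (q - p) = \<mu> q + r"
  then obtain p q where pq: "ribbon p q \<mu> \<eta>" "\<eta> p + (q - p) = \<mu> q + r" by blast
  then show "diagram \<mu> \<subseteq> diagram \<eta> \<and> skew \<eta> \<mu> \<in> BS r"
    using border_strip_ribbon[OF assms pq(1)] card_skew_ribbon[OF assms(1) pq(1)]
    by (simp add: BS_def)
qed

text \<open>
  In terms of shifted sequences the interlacing condition \<open>\<eta> (i + 1) = \<mu> i + 1\<close> says that the entry of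
  \<open>\<eta>\<close> at \<open>i + 1\<close> is the entry of \<open>\<mu>\<close> at \<open>i\<close>.  Hence adding a strip of \<open>r\<close> boxes in the rows
  \<open>p, \<dots>, q\<close> raises the entry at \<open>q\<close> by \<open>r\<close> and moves it to position \<open>p\<close>.
\<close>

lemma ribbon_iff_move:
  assumes "is_partition \<mu>" "plength \<mu> \<le> n" "is_partition \<eta>" "plength \<eta> \<le> n"
    and "1 \<le> p" "p \<le> q" "q \<le> n" "1 \<le> r"
  shows "ribbon p q \<mu> \<eta> \<and> \<eta> p + (q - p) = \<mu> q + r \<longleftrightarrow>
    (\<forall>i\<in>{1..n}. shifted n \<eta> i =
      move p q ((shifted n \<mu>)(q := shifted n \<mu> q + int r)) i)" (is "?L \<longleftrightarrow> ?R")
proof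
  assume L: ?L
  show ?R
  proof
    fix i assume i: "i \<in> {1..n}"
    consider "i = p" | "i \<notin> {p..q}" | k where "i = Suc k" "k \<in> {p..<q}"
      by (metis atLeastAtMost_iff atLeastLessThan_iff le_neq_implies_less less_Suc_eq_le
          not_less_eq_eq old.nat.exhaust Suc_le_lessD le_0_eq)
    then show "shifted n \<eta> i = move p q ((shifted n \<mu>)(q := shifted n \<mu> q + int r)) i"
      using L assms(5-7) i
      by cases (auto simp: ribbon_def move_def shifted_def delta_def)
  qed
next
  assume R: ?R
  have size: "\<eta> p + (q - p) = \<mu> q + r"
    using bspec[OF R, of p] assms(5-7) by (auto simp: move_def shifted_def delta_def)
  have out: "\<eta> i = \<mu> i" if "i \<notin> {p..q}" for i
  proof (cases "i \<in> {1..n}")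
    case True
    then show ?thesis using bspec[OF R True] that assms(6)
      by (auto simp: move_def shifted_def)
  next
    case False
    then have "i = 0 \<or> n < i" by auto
    then show ?thesis
      using assms(1-4) by (auto simp: plength_le_iff is_partition_def)
  qed
  have interlace: "\<eta> (Suc i) = Suc (\<mu> i)" if "i \<in> {p..<q}" for i
    using bspec[OF R, of "Suc i"] that assms(5-7)
    by (auto simp: move_def shifted_def delta_def)
  have "\<mu> p < \<eta> p"
  proof (cases "p = q")
    case True
    then show ?thesis using size assms(8) by simp
  next
    case False
    then show ?thesis
      using interlace[of p] partition_antimono[OF assms(3), of p "Suc p"] assms(5,6) by simp
  qed
  then show ?L unfolding ribbon_def using size out interlace assms(5,6) by blast
qed

section \<open>The three sums\<close>

text \<open>
  The common pattern of the first two sums.  The partitions in \<open>E\<close> are matched by \<open>R\<close> with those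
  positions \<open>q\<close> for which the changed sequence \<open>a q\<close> can be sorted into a partition; at the other positions
  the term \<open>G q\<close> vanishes.  A partition matched with \<open>q\<close> is unique because a strictly decreasing
  sequence is determined by its set of entries.
\<close>

lemma sum_over_rearrangements:
  assumes "finite I"
    and E: "\<And>\<nu>. \<nu> \<in> E \<Longrightarrow> is_partition \<nu> \<and> plength \<nu> \<le> n \<and> (\<exists>q\<in>I. R q \<nu>)"
    and unique: "\<And>q q' \<nu>. \<nu> \<in> E \<Longrightarrow> R q \<nu> \<Longrightarrow> R q' \<nu> \<Longrightarrow> q = q'"
    and entries: "\<And>q \<nu>. \<nu> \<in> E \<Longrightarrow> R q \<nu> \<Longrightarrow> rearrangement n (shifted n \<nu>) (a q)"
    and same_term: "\<And>q \<nu>. \<nu> \<in> E \<Longrightarrow> R q \<nu> \<Longrightarrow> F \<nu> = G q"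
    and unmatched: "\<And>q. q \<in> I \<Longrightarrow> G q = 0 \<or> (\<exists>\<nu>\<in>E. R q \<nu>)"
  shows "sum F E = sum G I"
proof -
  define Q where "Q = {q \<in> I. \<exists>\<nu>\<in>E. R q \<nu>}"
  have "\<exists>g. \<forall>q\<in>Q. g q \<in> E \<and> R q (g q)"
    by (rule bchoice) (auto simp: Q_def)
  then obtain g where g: "\<And>q. q \<in> Q \<Longrightarrow> g q \<in> E \<and> R q (g q)" by blast
  have eq: "\<nu> = \<nu>'" if "\<nu> \<in> E" "\<nu>' \<in> E" "R q \<nu>" "R q \<nu>'" for q \<nu> \<nu>'
  proof (rule partition_eqI)
    fix i assume "i \<in> {1..n}"
    moreover have "rearrangement n (shifted n \<nu>) (shifted n \<nu>')"
      using rearrangement_trans[OF entries rearrangement_sym[OF entries]] that by blast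
    ultimately show "shifted n \<nu> i = shifted n \<nu>' i"
      using E that by (intro decreasing_rearrangement_unique[of n] decreasing_shifted) auto
  qed (use E that in auto)
  have "bij_betw g Q E"
    unfolding bij_betw_def
  proof
    show "inj_on g Q" using g unique by (metis inj_onI)
    show "g ` Q = E"
    proof
      show "g ` Q \<subseteq> E" using g by blast
      show "E \<subseteq> g ` Q"
      proof
        fix \<nu> assume \<nu>: "\<nu> \<in> E"
        then obtain q where "q \<in> Q" "R q \<nu>" using E unfolding Q_def by blast
        then have "g q = \<nu>" using g eq \<nu> by blast
        then show "\<nu> \<in> g ` Q" using \<open>q \<in> Q\<close> by blast
      qed
    qed
  qed
  then have "sum F E = (\<Sum>q\<in>Q. F (g q))" by (simp add: sum.reindex_bij_betw)
  also have "\<dots> = sum G Q" using g same_term by (intro sum.cong) auto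
  also have "\<dots> = sum G I"
    using assms(1) unmatched by (intro sum.mono_neutral_left) (auto simp: Q_def)
  finally show ?thesis .
qed

text \<open>
  A strip starts at most one row below the diagram of \<open>\<mu>\<close>, and \<open>\<eta> p + (q - p) = \<mu> q + r\<close>
  bounds its number of rows, so only finitely many pairs \<open>(p, q)\<close> occur.
  Finiteness is needed because a sum over an infinite set is 0 by convention.
\<close>

lemma finite_border_strip_extensions:
  assumes "is_partition \<mu>"
  shows "finite {\<eta>. is_partition \<eta> \<and> diagram \<mu> \<subseteq> diagram \<eta> \<and> skew \<eta> \<mu> \<in> BS r}"
    (is "finite ?E")
proof -
  define L where "L = plength \<mu>"
  define B where "B = Suc L + \<mu> 1 + r"
  define f where "f = (\<lambda>(p, q) i. if i = p then \<mu> q + r - (q - p)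
      else if p < i \<and> i \<le> q then Suc (\<mu> (i - 1)) else \<mu> i)"
  \<comment> \<open>\<open>f (p, q)\<close> is the only candidate for an extension by a strip in the rows \<open>p, \<dots>, q\<close>.\<close>
  have "?E \<subseteq> f ` ({..B} \<times> {..B})"
  proof
    fix \<eta> assume E: "\<eta> \<in> ?E"
    then have part: "is_partition \<eta>" by simp
    obtain p q where rib: "ribbon p q \<mu> \<eta>" and size: "\<eta> p + (q - p) = \<mu> q + r"
      using E border_strip_iff_ribbon[OF assms part, of r] by auto
    have pq: "1 \<le> p" "p \<le> q" using rib by (simp_all add: ribbon_def)
    have zero: "\<mu> (Suc L) = 0"
      using plength_le_iff[OF assms, of L] by (simp add: L_def)
    have "p \<le> Suc L"
    proof (rule ccontr)
      assume "\<not> p \<le> Suc L"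
      then have "\<eta> p \<le> \<eta> (Suc L)" "\<eta> (Suc L) = \<mu> (Suc L)"
        using partition_antimono[OF part, of "Suc L" p] rib by (auto simp: ribbon_def)
      then show False using zero rib by (simp add: ribbon_def)
    qed
    moreover have "\<mu> q \<le> \<mu> 1"
      using partition_antimono[OF assms, of 1 q] pq by simp
    ultimately have "p \<le> B" "q \<le> B" using size by (simp_all add: B_def)
    moreover have "\<eta> = f (p, q)"
    proof
      fix i
      consider "i = p" | "i \<notin> {p..q}" | k where "i = Suc k" "k \<in> {p..<q}"
        by (cases i) force+
      then show "\<eta> i = f (p, q) i"
        using rib size pq by cases (auto simp: f_def ribbon_def)
    qed
    ultimately show "\<eta> \<in> f ` ({..B} \<times> {..B})" by blast
  qed
  then show ?thesis by (rule finite_subset) simp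
qed

lemma minus_one_power_self: "(-1 :: 'a :: comm_ring_1) ^ k * ((-1) ^ k * x) = x"
  by (simp flip: mult.assoc power_mult_distrib)

text \<open>
  A position \<open>q\<close> whose raised entry collides with another one contributes 0.  Otherwise sorting
  produces \<open>\<mu>\<close> with a strip added whose last row is \<open>q\<close>, and the sign of sorting cancels the sign
  of the strip.
\<close>

lemma sum_added_strips:
  assumes part: "is_partition \<mu>" and len: "plength \<mu> \<le> n" and r: "1 \<le> r"
  shows "(\<Sum>\<eta> \<in> {\<eta>. is_partition \<eta> \<and> diagram \<mu> \<subseteq> diagram \<eta> \<and> skew \<eta> \<mu> \<in> BS r}.
      (-1) ^ ht (skew \<eta> \<mu>) * sp n \<eta>) =
    (\<Sum>q=1..n. alternant n ((shifted n \<mu>)(q := shifted n \<mu> q + int r)) /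
      alternant n (\<lambda>i. int (delta n i)))"
proof -
  let ?E = "{\<eta>. is_partition \<eta> \<and> diagram \<mu> \<subseteq> diagram \<eta> \<and> skew \<eta> \<mu> \<in> BS r}"
  let ?F = "\<lambda>\<eta>. (-1) ^ ht (skew \<eta> \<mu>) * sp n \<eta>"
  let ?D = "alternant n (\<lambda>i. int (delta n i))"
  define a where "a = shifted n \<mu>"
  define a' where "a' q = a(q := a q + int r)" for q
  define E where "E = {\<eta> \<in> ?E. plength \<eta> \<le> n}"
  define R where "R q \<eta> \<longleftrightarrow> (\<exists>p. ribbon p q \<mu> \<eta> \<and> \<eta> p + (q - p) = \<mu> q + r)" for q \<eta>
  have a: "decreasing n a" unfolding a_def by (rule decreasing_shifted[OF part])
  have E_iff: "\<eta> \<in> E \<longleftrightarrow> is_partition \<eta> \<and> plength \<eta> \<le> n \<and> (\<exists>q. R q \<eta>)" for \<eta>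
    unfolding E_def R_def using border_strip_iff_ribbon[OF part, of \<eta> r] by auto
  have moved: "\<exists>p. 1 \<le> p \<and> p \<le> q \<and> q \<le> n \<and> ht (skew \<eta> \<mu>) = q - p \<and>
      (\<forall>i\<in>{1..n}. shifted n \<eta> i = move p q (a' q) i)"
    if "\<eta> \<in> E" and R: "R q \<eta>" for q \<eta>
  proof -
    have \<eta>: "is_partition \<eta>" "plength \<eta> \<le> n" using that E_iff by auto
    obtain p where p: "ribbon p q \<mu> \<eta>" "\<eta> p + (q - p) = \<mu> q + r"
      using R unfolding R_def by blast
    then have pq: "1 \<le> p" "p \<le> q" by (simp_all add: ribbon_def)
    have "\<eta> q \<noteq> 0" using ribbon_row[OF part p(1), of q] pq by simp
    then have qn: "q \<le> n" using plength_le_iff[OF \<eta>(1), of n] \<eta>(2) by (meson not_le)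
    then show ?thesis
      using ribbon_iff_move[OF part len \<eta> pq qn r] p ht_ribbon[OF part p(1)] pq
      unfolding a'_def a_def by blast
  qed
  \<comment> \<open>Partitions with more than \<open>n\<close> parts have \<open>sp = 0\<close>.\<close>
  have "sum ?F ?E = sum ?F E"
    by (rule sum.mono_neutral_right[OF finite_border_strip_extensions[OF part]])
       (auto simp: E_def sp_def)
  also have "\<dots> = (\<Sum>q=1..n. alternant n (a' q) / ?D)"
  proof (rule sum_over_rearrangements[where R = R and a = a' and n = n])
    fix \<eta> assume \<eta>: "\<eta> \<in> E"
    then obtain q where R: "R q \<eta>" unfolding E_iff by blast
    then have "q \<in> {1..n}" using moved[OF \<eta> R] by auto
    then show "is_partition \<eta> \<and> plength \<eta> \<le> n \<and> (\<exists>q\<in>{1..n}. R q \<eta>)"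
      using \<eta> R unfolding E_iff by blast
  next
    fix q q' \<eta> assume "R q \<eta>" "R q' \<eta>"
    then show "q = q'" unfolding R_def using ribbon_rows_unique[OF part] by blast
  next
    fix q \<eta> assume \<eta>: "\<eta> \<in> E" and R: "R q \<eta>"
    obtain p where p: "1 \<le> p" "p \<le> q" "q \<le> n" and ht: "ht (skew \<eta> \<mu>) = q - p"
      and eq: "\<And>i. i \<in> {1..n} \<Longrightarrow> shifted n \<eta> i = move p q (a' q) i"
      using moved[OF \<eta> R] by blast
    show "rearrangement n (shifted n \<eta>) (a' q)"
      using rearrangement_trans[OF rearrangement_cong[OF eq] rearrangement_move[OF p]] .
    have "alternant n (shifted n \<eta>) = (-1) ^ (q - p) * alternant n (a' q)"
      using alternant_cong[OF eq] alternant_move[OF p] by simp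
    then show "?F \<eta> = alternant n (a' q) / ?D"
      using \<eta> unfolding E_iff by (simp add: sp_eq_alternant ht minus_one_power_self)
  next
    fix q assume q: "q \<in> {1..n}"
    show "alternant n (a' q) / ?D = 0 \<or> (\<exists>\<eta>\<in>E. R q \<eta>)"
    proof (cases "\<exists>j\<in>{1..n}. j \<noteq> q \<and> a j = a q + int r")
      case True
      then obtain j where "j \<in> {1..n}" "j \<noteq> q" "a j = a q + int r" by blast
      then have "alternant n (a' q) = 0"
        using q by (intro alternant_equal_entries[of j n q]) (simp_all add: a'_def)
      then show ?thesis by simp
    next
      case False
      then have fresh: "\<And>j. j \<in> {1..n} \<Longrightarrow> j \<noteq> q \<Longrightarrow> a j \<noteq> a q + int r" by blast
      obtain p where p: "1 \<le> p" "p \<le> q" and b: "decreasing n (move p q (a' q))"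
        unfolding a'_def by (rule insert_larger_entry[OF a q _ fresh]) auto
      let ?\<eta> = "unshifted n (move p q (a' q))"
      have pos: "0 < a' q i" if "i \<in> {1..n}" for i
        using that q shifted_pos[of i n \<mu>] shifted_pos[of q n \<mu>] by (simp add: a'_def a_def)
      have "move p q (a' q) ` {1..n} = a' q ` {1..n}"
        using p q by (intro rearrangement_image rearrangement_move) auto
      then have "0 < move p q (a' q) i" if "i \<in> {1..n}" for i
        using that pos by (metis imageE imageI)
      then have "shifted n ?\<eta> i = move p q (a' q) i" if "i \<in> {1..n}" for i
        using shifted_unshifted[OF b] that by blast
      then have "R q ?\<eta>"
        using ribbon_iff_move[OF part len partition_unshifted[OF b] p _ r] q
        unfolding R_def a'_def a_def by auto
      then show ?thesis
        using partition_unshifted[OF b] unfolding Bex_def E_iff by blast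
    qed
  qed simp
  finally show ?thesis by (simp add: a'_def a_def)
qed

text \<open>
  The positions \<open>p\<close> with \<open>a p \<ge> r\<close>, where lowering does not produce a negative exponent.  A collision
  contributes 0, and so does \<open>a p = r\<close>, where the lowered exponent is 0.  Otherwise sorting produces \<open>\<mu>\<close>
  with a strip removed whose first row is \<open>p\<close>.
\<close>

lemma sum_removed_strips:
  assumes part: "is_partition \<mu>" and len: "plength \<mu> \<le> n" and r: "1 \<le> r"
  shows "(\<Sum>\<xi> \<in> {\<xi>. is_partition \<xi> \<and> diagram \<xi> \<subseteq> diagram \<mu> \<and> skew \<mu> \<xi> \<in> BS r}.
      (-1) ^ ht (skew \<mu> \<xi>) * sp n \<xi>) =
    (\<Sum>p\<in>{p\<in>{1..n}. int r \<le> shifted n \<mu> p}.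
      alternant n ((shifted n \<mu>)(p := shifted n \<mu> p - int r)) /
      alternant n (\<lambda>i. int (delta n i)))"
proof -
  let ?F = "\<lambda>\<xi>. (-1) ^ ht (skew \<mu> \<xi>) * sp n \<xi>"
  let ?D = "alternant n (\<lambda>i. int (delta n i))"
  define a where "a = shifted n \<mu>"
  define a' where "a' p = a(p := a p - int r)" for p
  define E where "E = {\<xi>. is_partition \<xi> \<and> diagram \<xi> \<subseteq> diagram \<mu> \<and> skew \<mu> \<xi> \<in> BS r}"
  define R where "R p \<xi> \<longleftrightarrow> (\<exists>q. ribbon p q \<xi> \<mu> \<and> \<mu> p + (q - p) = \<xi> q + r)" for p \<xi>
  have a: "decreasing n a" unfolding a_def by (rule decreasing_shifted[OF part])
  have E_iff: "\<xi> \<in> E \<longleftrightarrow> is_partition \<xi> \<and> (\<exists>p. R p \<xi>)" for \<xi>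
    unfolding E_def R_def using border_strip_iff_ribbon[OF _ part, of \<xi> r] by auto
  have E_len: "plength \<xi> \<le> n" if "\<xi> \<in> E" for \<xi>
  proof -
    have "\<xi> i \<le> \<mu> i" if "n < i" for i
      using \<open>\<xi> \<in> E\<close> that by (auto simp: E_def diagram_subset_iff)
    then show ?thesis
      using that len part plength_le_iff by (metis E_iff le_zero_eq)
  qed
  \<comment> \<open>Raising entry \<open>q\<close> of \<open>\<xi>\<close> and moving it to \<open>p\<close> gives \<open>\<mu>\<close> iff lowering entry \<open>p\<close> of \<open>\<mu>\<close>
    gives the moved sequence of \<open>\<xi>\<close>.\<close>
  have move_iff: "(\<forall>i\<in>{1..n}. a i = move p q ((shifted n \<xi>)(q := shifted n \<xi> q + int r)) i) \<longleftrightarrow>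
      (\<forall>i\<in>{1..n}. a' p i = move p q (shifted n \<xi>) i)"
    if "1 \<le> p" "p \<le> q" "q \<le> n" for p q \<xi>
    using that by (intro ball_cong refl) (auto simp: move_def a'_def)
  have moved: "\<exists>q. 1 \<le> p \<and> p \<le> q \<and> q \<le> n \<and> ht (skew \<mu> \<xi>) = q - p \<and>
      (\<forall>i\<in>{1..n}. a' p i = move p q (shifted n \<xi>) i)"
    if E: "\<xi> \<in> E" and R: "R p \<xi>" for p \<xi>
  proof -
    have \<xi>: "is_partition \<xi>" "plength \<xi> \<le> n" using E E_iff E_len by auto
    obtain q where q: "ribbon p q \<xi> \<mu>" "\<mu> p + (q - p) = \<xi> q + r"
      using R unfolding R_def by blast
    then have pq: "1 \<le> p" "p \<le> q" by (simp_all add: ribbon_def)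
    have "\<mu> q \<noteq> 0" using ribbon_row[OF \<xi>(1) q(1), of q] pq by simp
    then have qn: "q \<le> n" using plength_le_iff[OF part, of n] len by (meson not_le)
    have "\<forall>i\<in>{1..n}. a i = move p q ((shifted n \<xi>)(q := shifted n \<xi> q + int r)) i"
      using ribbon_iff_move[OF \<xi> part len pq qn r] q unfolding a_def by blast
    then show ?thesis
      using move_iff[OF pq qn] ht_ribbon[OF \<xi>(1) q(1)] pq qn by blast
  qed
  have "sum ?F E = (\<Sum>p\<in>{p\<in>{1..n}. int r \<le> a p}. alternant n (a' p) / ?D)"
  proof (rule sum_over_rearrangements[where R = R and a = a' and n = n])
    fix \<xi> assume \<xi>: "\<xi> \<in> E"
    then obtain p where R: "R p \<xi>" unfolding E_iff by blast
    obtain q where q: "1 \<le> p" "p \<le> q" "q \<le> n"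
      and eq: "\<And>i. i \<in> {1..n} \<Longrightarrow> a' p i = move p q (shifted n \<xi>) i"
      using moved[OF \<xi> R] by blast
    have "0 < a' p p"
      using eq[of p] q shifted_pos[of q n \<xi>] by (simp add: move_def)
    then have "p \<in> {p\<in>{1..n}. int r \<le> a p}" using q by (simp add: a'_def)
    then show "is_partition \<xi> \<and> plength \<xi> \<le> n \<and> (\<exists>p\<in>{p\<in>{1..n}. int r \<le> a p}. R p \<xi>)"
      using \<xi> R E_len unfolding E_iff by blast
  next
    fix p p' \<xi> assume "\<xi> \<in> E" "R p \<xi>" "R p' \<xi>"
    then show "p = p'" unfolding R_def E_iff using ribbon_rows_unique by blast
  next
    fix p \<xi> assume \<xi>: "\<xi> \<in> E" and R: "R p \<xi>"
    obtain q where q: "1 \<le> p" "p \<le> q" "q \<le> n" and ht: "ht (skew \<mu> \<xi>) = q - p"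
      and eq: "\<And>i. i \<in> {1..n} \<Longrightarrow> a' p i = move p q (shifted n \<xi>) i"
      using moved[OF \<xi> R] by blast
    show "rearrangement n (shifted n \<xi>) (a' p)"
      using rearrangement_trans[OF rearrangement_cong[OF eq] rearrangement_move[OF q]]
      by (rule rearrangement_sym)
    have "alternant n (a' p) = (-1) ^ (q - p) * alternant n (shifted n \<xi>)"
      using alternant_cong[OF eq] alternant_move[OF q] by simp
    then show "?F \<xi> = alternant n (a' p) / ?D"
      using E_len[OF \<xi>] by (simp add: sp_eq_alternant ht)
  next
    fix p assume "p \<in> {p\<in>{1..n}. int r \<le> a p}"
    then have p: "p \<in> {1..n}" and le: "int r \<le> a p" by auto
    consider "a p = int r" | "\<exists>j\<in>{1..n}. j \<noteq> p \<and> a j = a p - int r"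
      | "int r < a p" "\<forall>j\<in>{1..n}. j \<noteq> p \<longrightarrow> a j \<noteq> a p - int r"
      using le by force
    then show "alternant n (a' p) / ?D = 0 \<or> (\<exists>\<xi>\<in>E. R p \<xi>)"
    proof cases
      case 1
      then show ?thesis using alternant_zero_entry[OF p, of a] by (simp add: a'_def)
    next
      case 2
      then obtain j where "j \<in> {1..n}" "j \<noteq> p" "a j = a p - int r" by blast
      then have "alternant n (a' p) = 0"
        using p by (intro alternant_equal_entries[of j n p]) (simp_all add: a'_def)
      then show ?thesis by simp
    next
      case 3
      then have fresh: "\<And>j. j \<in> {1..n} \<Longrightarrow> j \<noteq> p \<Longrightarrow> a j \<noteq> a p - int r" by blast
      obtain q b where q: "p \<le> q" "q \<le> n" and b: "decreasing n b" and a': "a' p = move p q b"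
        unfolding a'_def by (rule insert_smaller_entry[OF a p _ fresh]) auto
      let ?\<xi> = "unshifted n b"
      have pos: "0 < a' p i" if "i \<in> {1..n}" for i
        using that shifted_pos[of i n \<mu>] 3(1) by (simp add: a'_def a_def)
      have "a' p ` {1..n} = b ` {1..n}"
        unfolding a' using p q by (intro rearrangement_image rearrangement_move) auto
      then have "0 < b i" if "i \<in> {1..n}" for i
        using that pos by (metis imageE imageI)
      then have sh: "shifted n ?\<xi> i = b i" if "i \<in> {1..n}" for i
        using shifted_unshifted[OF b] that by blast
      have "a' p i = move p q (shifted n ?\<xi>) i" if "i \<in> {1..n}" for i
        unfolding a' using that p q sh by (cases i) (auto simp: move_def)
      then have "R p ?\<xi>"
        using ribbon_iff_move[OF partition_unshifted[OF b] part len _ q r] move_iff[of p q ?\<xi>] p q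
        unfolding R_def a_def by auto
      then show ?thesis
        using partition_unshifted[OF b] unfolding Bex_def E_iff by blast
    qed
  qed simp
  then show ?thesis by (simp add: E_def a'_def a_def)
qed

text \<open>
  Since the shifted sequence decreases, its entries below \<open>r\<close> form the final segment that starts after
  \<open>m_index n r \<mu>\<close>.
\<close>

lemma m_index_less_iff:
  assumes "is_partition \<mu>" "q \<in> {1..n}"
  shows "m_index n r \<mu> < q \<longleftrightarrow> shifted n \<mu> q < int r"
proof -
  let ?A = "{i \<in> {1..n}. r \<le> \<mu> i + delta n i}"
  have in_A: "i \<in> ?A \<longleftrightarrow> i \<in> {1..n} \<and> int r \<le> shifted n \<mu> i" for i
    unfolding shifted_def by auto
  show ?thesis
  proof (cases "?A = {}")
    case True
    then have "m_index n r \<mu> = 0" unfolding m_index_def using not_le by auto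
    moreover have "\<not> int r \<le> shifted n \<mu> q" using in_A[of q] assms(2) True by blast
    ultimately show ?thesis using assms(2) by auto
  next
    case False
    have m: "m_index n r \<mu> = Max ?A" using False unfolding m_index_def by force
    have "Max ?A \<in> ?A" using False by (intro Max_in) auto
    have "q \<le> Max ?A \<longleftrightarrow> int r \<le> shifted n \<mu> q"
    proof
      assume "q \<le> Max ?A"
      then have "shifted n \<mu> (Max ?A) \<le> shifted n \<mu> q"
        using \<open>Max ?A \<in> ?A\<close> assms(2)
        by (intro decreasing_le[OF decreasing_shifted[OF assms(1)]]) auto
      then show "int r \<le> shifted n \<mu> q" using \<open>Max ?A \<in> ?A\<close> unfolding in_A by linarith
    next
      assume "int r \<le> shifted n \<mu> q"
      then have "q \<in> ?A" using assms(2) unfolding in_A by blast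
      then show "q \<le> Max ?A" by (intro Max_ge) auto
    qed
    then show ?thesis unfolding m by linarith
  qed
qed

text \<open>
  Any strictly decreasing rearrangement \<open>b\<close> of the changed sequence is the sorted list
  \<open>Delta n r \<mu> q\<close>, so both the position and the partition defined from that list can be read off from \<open>b\<close>.
\<close>

lemma p_index_mu_q:
  assumes b: "decreasing n b" and pos: "\<And>i. i \<in> {1..n} \<Longrightarrow> 0 < b i"
    and perm: "rearrangement n b ((shifted n \<mu>)(q := new_entry n r \<mu> q))"
    and p: "p \<in> {1..n}" "b p = new_entry n r \<mu> q"
  shows "p_index n r \<mu> q = p"
    and "sp n (mu_q n r \<mu> q) = alternant n b / alternant n (\<lambda>i. int (delta n i))"
proof -
  have "(\<lambda>i. if i = q then new_entry n r \<mu> q else int (\<mu> i + delta n i)) =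
      (shifted n \<mu>)(q := new_entry n r \<mu> q)"
    by (auto simp: fun_eq_iff shifted_def)
  then have "Delta n r \<mu> q = map b [1..<Suc n]"
    unfolding Delta_def using rev_sort_decreasing[OF b perm] by (simp only:)
  then have nth: "Delta n r \<mu> q ! (i - 1) = b i" if "i \<in> {1..n}" for i
    using that by (auto simp del: upt_Suc)
  show "p_index n r \<mu> q = p"
    unfolding p_index_def
  proof (rule the_equality)
    show "p \<in> {1..n} \<and> Delta n r \<mu> q ! (p - 1) = new_entry n r \<mu> q"
      using p nth by simp
    fix p' assume "p' \<in> {1..n} \<and> Delta n r \<mu> q ! (p' - 1) = new_entry n r \<mu> q"
    then show "p' = p"
      using p nth decreasing_inj_on[OF b] by (metis inj_onD)
  qed
  have "mu_q n r \<mu> q = unshifted n b"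
    unfolding mu_q_def unshifted_def using nth by (auto simp: fun_eq_iff)
  moreover have "alternant n (shifted n (unshifted n b)) = alternant n b"
    using shifted_unshifted[OF b pos] by (intro alternant_cong) blast
  ultimately show "sp n (mu_q n r \<mu> q) = alternant n b / alternant n (\<lambda>i. int (delta n i))"
    using partition_unshifted[OF b] by (simp add: sp_eq_alternant)
qed

lemma minus_one_powi_Suc_diff:
  assumes "p \<le> q"
  shows "(-1 :: 'a :: field) powi (int p - int q + 1) = - ((-1) ^ (q - p))"
proof -
  have eq: "int p - int q + 1 = - int (q - p) + 1" using assms by simp
  have "(-1 :: 'a) powi (int p - int q + 1) = (-1) powi (- int (q - p)) * (-1) powi 1"
    unfolding eq by (rule power_int_add) simp
  then show ?thesis
    by (simp only: power_int_minus_one_minus power_int_of_nat power_int_1_right mult_minus1_right)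
qed

text \<open>
  The lowered entry \<open>a q - r\<close> is the negative of \<open>v = r - a q\<close>; the change of sign is the summand 1 in the
  exponent of -1.  Sorting then moves \<open>v\<close> from \<open>q\<close> to \<open>p\<close>, to the left or to the right according to
  its size.
\<close>

lemma reflected_term:
  assumes part: "is_partition \<mu>" and q: "q \<in> {1..n}" and neg: "shifted n \<mu> q < int r"
  shows "(-1) powi (int (p_index n r \<mu> q) - int q + 1) * sp_mu_q n r \<mu> q =
    alternant n ((shifted n \<mu>)(q := shifted n \<mu> q - int r)) /
      alternant n (\<lambda>i. int (delta n i))"
proof -
  let ?D = "alternant n (\<lambda>i. int (delta n i))"
  define a where "a = shifted n \<mu>"
  define v where "v = new_entry n r \<mu> q"
  have v: "v = int r - a q" by (simp add: v_def new_entry_def a_def shifted_def)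
  define a' where "a' = a(q := v)"
  have a: "decreasing n a" unfolding a_def by (rule decreasing_shifted[OF part])
  have neg_alt: "alternant n (a(q := a q - int r)) = - alternant n a'"
    using alternant_negated_entry[OF q, of a v] by (simp add: a'_def v)
  have coll: "collision n r \<mu> q \<longleftrightarrow> (\<exists>j\<in>{1..n}. j \<noteq> q \<and> a j = v)"
    unfolding collision_def v_def a_def shifted_def by auto
  show ?thesis
  proof (cases "collision n r \<mu> q")
    case True
    then obtain j where "j \<in> {1..n}" "j \<noteq> q" "a j = v" unfolding coll by blast
    then have "alternant n a' = 0"
      using alternant_equal_entries[of j n q a'] q by (simp add: a'_def)
    then show ?thesis using True neg_alt by (simp add: sp_mu_q_def a_def)
  next
    case False
    then have fresh: "\<And>j. j \<in> {1..n} \<Longrightarrow> j \<noteq> q \<Longrightarrow> a j \<noteq> v" unfolding coll by blast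
    have "\<exists>p b. p \<in> {1..n} \<and> decreasing n b \<and> b p = v \<and>
        rearrangement n b a' \<and>
        (-1) powi (int p - int q + 1) * alternant n b = - alternant n a'"
    proof (cases "a q \<le> v")
      case True
      obtain p where p: "1 \<le> p" "p \<le> q" and b: "decreasing n (move p q a')"
        unfolding a'_def by (rule insert_larger_entry[OF a q True fresh])
      have "(-1 :: ratfun) powi (int p - int q + 1) = - ((-1) ^ (q - p))"
        by (rule minus_one_powi_Suc_diff[OF p(2)])
      moreover have "alternant n (move p q a') = (-1) ^ (q - p) * alternant n a'"
        using p q by (intro alternant_move) auto
      ultimately have "(-1) powi (int p - int q + 1) * alternant n (move p q a') = - alternant n a'"
        by (simp only: mult_minus_left minus_one_power_self)
      moreover have "move p q a' p = v" by (simp add: move_def a'_def)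
      moreover have "rearrangement n (move p q a') a'"
        using p q by (intro rearrangement_move) auto
      moreover have "p \<in> {1..n}" using p q by simp
      ultimately show ?thesis using b by blast
    next
      case False
      then have "v \<le> a q" by simp
      then obtain p b where p: "q \<le> p" "p \<le> n" and b: "decreasing n b" and m: "a' = move q p b"
        unfolding a'_def by (rule insert_smaller_entry[OF a q _ fresh])
      have "int p - int q + 1 = int (Suc (p - q))" using p by simp
      then have "(-1 :: ratfun) powi (int p - int q + 1) = - ((-1) ^ (p - q))"
        by (simp only: power_int_of_nat power_Suc mult_minus1)
      moreover have "alternant n a' = (-1) ^ (p - q) * alternant n b"
        unfolding m using p q by (intro alternant_move) auto
      ultimately have "(-1) powi (int p - int q + 1) * alternant n b = - alternant n a'"
        by (simp only: mult_minus_left)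
      moreover have "b p = v"
        using fun_cong[OF m, of q] by (simp add: move_def a'_def)
      moreover have "rearrangement n b a'"
        unfolding m using p q by (intro rearrangement_sym[OF rearrangement_move]) auto
      moreover have "p \<in> {1..n}" using p q by simp
      ultimately show ?thesis using b by blast
    qed
    then obtain p b where p: "p \<in> {1..n}" "b p = v" and b: "decreasing n b"
      and perm: "rearrangement n b a'"
      and sign: "(-1) powi (int p - int q + 1) * alternant n b = - alternant n a'"
      by blast
    have "0 < a' i" if "i \<in> {1..n}" for i
      using that shifted_pos[of i n \<mu>] neg by (simp add: a'_def a_def v)
    moreover have "b ` {1..n} = a' ` {1..n}"
      by (rule rearrangement_image[OF perm])
    ultimately have pos: "0 < b i" if "i \<in> {1..n}" for i
      using that by (metis imageE imageI)
    note p_index_mu_q[OF b pos perm[unfolded a'_def a_def v_def] p[unfolded v_def]]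
    then have "(-1) powi (int (p_index n r \<mu> q) - int q + 1) * sp_mu_q n r \<mu> q =
        - alternant n a' / ?D"
      using False sign by (simp add: sp_mu_q_def)
    then show ?thesis using neg_alt by (simp add: a_def)
  qed
qed

theorem theorem3p4:
  fixes n r :: nat and \<mu> :: "nat \<Rightarrow> nat"
  assumes "n \<ge> 1"
    and "is_partition \<mu>"
    and "plength \<mu> \<le> n"
    and "r \<ge> 1"
  shows "pbar n r * sp n \<mu> =
      (\<Sum>\<eta> \<in> {\<eta>. is_partition \<eta> \<and> diagram \<mu> \<subseteq> diagram \<eta> \<and> skew \<eta> \<mu> \<in> BS r}.
          (-1) ^ ht (skew \<eta> \<mu>) * sp n \<eta>)
    + (\<Sum>\<xi> \<in> {\<xi>. is_partition \<xi> \<and> diagram \<xi> \<subseteq> diagram \<mu> \<and> skew \<mu> \<xi> \<in> BS r}.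
          (-1) ^ ht (skew \<mu> \<xi>) * sp n \<xi>)
    + (\<Sum>q = m_index n r \<mu> + 1..n.
          (-1) powi (int (p_index n r \<mu> q) - int q + 1) * sp_mu_q n r \<mu> q)"
proof -
  define a where "a = shifted n \<mu>"
  define D where "D = alternant n (\<lambda>i. int (delta n i))"
  define up where "up q = alternant n (a(q := a q + int r))" for q
  define down where "down q = alternant n (a(q := a q - int r))" for q
  let ?hi = "{q \<in> {1..n}. int r \<le> a q}" and ?lo = "{m_index n r \<mu> + 1..n}"
  have lo: "q \<in> {1..n}" "a q < int r" if "q \<in> ?lo" for q
    using that m_index_less_iff[OF assms(2), of q n r] by (auto simp: a_def)
  have split: "{1..n} = ?hi \<union> ?lo" "?hi \<inter> ?lo = {}"
    using m_index_less_iff[OF assms(2), of _ n r] unfolding a_def by fastforce+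
  have "pbar n r * sp n \<mu> = (\<Sum>q=1..n. up q + down q) / D"
    using assms(3) pbar_times_alternant[of n r a]
    by (simp add: sp_eq_alternant D_def a_def up_def down_def)
  also have "\<dots> = (\<Sum>q=1..n. up q) / D + (\<Sum>q=1..n. down q) / D"
    by (simp add: sum.distrib add_divide_distrib)
  also have "(\<Sum>q=1..n. down q) = sum down ?hi + sum down ?lo"
    by (subst split(1), rule sum.union_disjoint[OF _ _ split(2)]) auto
  also have "\<dots> / D = sum down ?hi / D + (\<Sum>q\<in>?lo. down q / D)"
    by (simp add: add_divide_distrib sum_divide_distrib)
  also have "(\<Sum>q\<in>?lo. down q / D) = (\<Sum>q\<in>?lo.
      (-1) powi (int (p_index n r \<mu> q) - int q + 1) * sp_mu_q n r \<mu> q)"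
    unfolding down_def D_def a_def
    using lo by (intro sum.cong refl reflected_term[OF assms(2), symmetric]) (auto simp: a_def)
  finally show ?thesis
    unfolding sum_added_strips[OF assms(2-4)] sum_removed_strips[OF assms(2-4)]
    by (simp only: up_def down_def D_def a_def add.assoc sum_divide_distrib)
qed

end
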